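(* Let $(\phi^n)_{n=0}^{N}$, with multipliers $(\xi^n)_{n=1}^{N}$, be a sequence each of whose steps $n\to n+1$ ($0\le n\le N-1$) satisfies the one-dimensional fully-discrete upwind-SAV scheme described in the context. Then the total mass is conserved: for every $0\le n\le N-1$, $$\sum_{i=1}^{N_x}\phi_i^{n+1}=\sum_{i=1}^{N_x}\phi_i^{n}=\cdots=\sum_{i=1}^{N_x}\phi_i^{0}.$$
   Context: Parameters: an integer $N_x\ge 2$ (number of cells), cell size $\Delta x>0$, time step $\Delta t>0$, interface parameter $\varepsilon>0$, a positive integer $k$. The potential $F:I\to\mathbb{R}$ is the free energy density, differentiable on its domain of definition $I\subseteq\mathbb{R}$, an interval; typical choices are the logarithmic Flory--Huggins potential $F(\phi)=\frac{\theta}{2}[(1+\phi)\ln(1+\phi)+(1-\phi)\ln(1-\phi)]+\frac{\theta_c}{2}(1-\phi^2)$ with $0<\theta<\theta_c$ (differentiable on $I=(-1,1)$), or the polynomial potential $F(\phi)=\frac14(1-\phi^2)^2$ (with $I=\mathbb{R}$). Notation: $\chi^+=\max\{\chi,0\}$, $\chi^-=\min\{\chi,0\}$, and the mobility is $M(\chi_1,\chi_2)=\big[(1+\chi_1)^+(1-\chi_2)^+\big]^k$. Scheme: one step from the cell averages $\phi^n=(\phi_i^n)_{i=1}^{N_x}$ to $\phi^{n+1}=(\phi_i^{n+1})_{i=1}^{N_x}$ and $\xi^{n+1}\in\mathbb{R}$ (all cell averages in $I$) means that the following hold: $$\phi_i^{n+1}-\phi_i^n=-\frac{\Delta t}{\Delta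 x}\left(J_{i+\frac12}^{n+1}-J_{i-\frac12}^{n+1}\right),\quad 1\le i\le N_x,$$ $$J_{i+\frac12}^{n+1}=\left(V_{i+\frac12}^{n+1}\right)^+M(\phi_i^{n+1},\phi_{i+1}^{n+1})+\left(V_{i+\frac12}^{n+1}\right)^-M(\phi_{i+1}^{n+1},\phi_i^{n+1}),\quad 1\le i\le N_x-1,$$ $$V_{i+\frac12}^{n+1}=-\frac{1}{\Delta x}\left(\mu_{i+1}^{n+1}-\mu_i^{n+1}\right),\quad 1\le i\le N_x-1,$$ $$\mu_i^{n+1}=-\varepsilon^2(\Delta\phi)_i^{n+1}+\xi^{n+1}F'(\phi_i^{n+1}),\quad 1\le i\le N_x,$$ $$\sum_{i=1}^{N_x}\left(F(\phi_i^{n+1})-F(\phi_i^n)\right)=\xi^{n+1}\sum_{i=1}^{N_x}F'(\phi_i^{n+1})(\phi_i^{n+1}-\phi_i^n),$$ where $(\nabla\phi)_{i+\frac12}^{n}=\frac{\phi_{i+1}^{n}-\phi_i^{n}}{\Delta x}$ for $1\le i\le N_x-1$, $(\nabla\phi)_{\frac12}^{n}=(\nabla\phi)_{N_x+\frac12}^{n}=0$, $(\Delta\phi)_i^{n+1}=\frac{(\nabla\phi)_{i+\frac12}^{n+1}-(\nabla\phi)_{i-\frac12}^{n+1}}{\Delta x}$ for $1\le i\le N_x$, and the no-flux boundary conditions are $J_{\frac12}^{n+1}=J_{N_x+\frac12}^{n+1}=0$. *)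

theory Defs
  imports "HOL-Analysis.Analysis"
begin

text \<open>Cells carry the indices \<open>1..Nx\<close>. A quantity living on the interface \<open>i + 1/2\<close> is
  stored at index \<open>i\<close>, so that interfaces range over \<open>0..Nx\<close> and the value at \<open>i - 1/2\<close>
  is found at index \<open>i - 1\<close>; the indices \<open>0\<close> and \<open>Nx\<close> are the two boundary points.\<close>

definition mobility :: "nat \<Rightarrow> real \<Rightarrow> real \<Rightarrow> real" where
  "mobility k x y = (max (1 + x) 0 * max (1 - y) 0) ^ k"

definition grad :: "nat \<Rightarrow> real \<Rightarrow> (nat \<Rightarrow> real) \<Rightarrow> nat \<Rightarrow> real" where
  "grad Nx dx \<phi> i = (if i = 0 \<or> i = Nx then 0 else (\<phi> (i + 1) - \<phi> i) / dx)"

definition laplacian :: "nat \<Rightarrow> real \<Rightarrow> (nat \<Rightarrow> real) \<Rightarrow> nat \<Rightarrow> real" where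
  "laplacian Nx dx \<phi> i = (grad Nx dx \<phi> i - grad Nx dx \<phi> (i - 1)) / dx"

text \<open>One time step from \<open>\<phi>\<close> to \<open>\<psi>\<close> with multiplier \<open>\<xi>\<close>. The fluxes \<open>J\<close>, velocities \<open>V\<close> and
  chemical potentials \<open>\<mu>\<close> are determined by \<open>\<psi>\<close> and \<open>\<xi>\<close> at all indices that occur.\<close>

definition upwind_sav_step ::
  "nat \<Rightarrow> real \<Rightarrow> real \<Rightarrow> real \<Rightarrow> nat \<Rightarrow> real set \<Rightarrow> (real \<Rightarrow> real) \<Rightarrow> (real \<Rightarrow> real)
    \<Rightarrow> (nat \<Rightarrow> real) \<Rightarrow> (nat \<Rightarrow> real) \<Rightarrow> real \<Rightarrow> bool" where
  "upwind_sav_step Nx dx dt \<epsilon> k I F F' \<phi> \<psi> \<xi> \<longleftrightarrow>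
    (\<forall>i\<in>{1..Nx}. \<phi> i \<in> I \<and> \<psi> i \<in> I) \<and>
    (\<exists>J V \<mu> :: nat \<Rightarrow> real.
      (\<forall>i\<in>{1..Nx}. \<psi> i - \<phi> i = - (dt / dx) * (J i - J (i - 1))) \<and>
      (\<forall>i\<in>{1..Nx - 1}. J i = max (V i) 0 * mobility k (\<psi> i) (\<psi> (i + 1))
                          + min (V i) 0 * mobility k (\<psi> (i + 1)) (\<psi> i)) \<and>
      J 0 = 0 \<and> J Nx = 0 \<and>
      (\<forall>i\<in>{1..Nx - 1}. V i = - (1 / dx) * (\<mu> (i + 1) - \<mu> i)) \<and>
      (\<forall>i\<in>{1..Nx}. \<mu> i = - (\<epsilon>\<^sup>2) * laplacian Nx dx \<psi> i + \<xi> * F' (\<psi> i))) \<and>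
    (\<Sum>i=1..Nx. F (\<psi> i) - F (\<phi> i)) = \<xi> * (\<Sum>i=1..Nx. F' (\<psi> i) * (\<psi> i - \<phi> i))"

end

theory Submission
  imports Defs
begin

text \<open>The scheme is in conservation form: each cell average changes by the common factor
  \<open>- (dt / dx)\<close> times the difference of the fluxes at its two interfaces. Neighbouring
  cells share the flux at their common interface, so on summing over the cells the interior fluxes
  cancel (\<open>sum_diff_pred_telescope\<close>) and only the two boundary fluxes remain; these
  vanish by the no-flux condition. Hence each step preserves the mass
  (\<open>upwind_sav_step_mass\<close>), and induction over time gives the claim.\<close>

lemma sum_diff_pred_telescope:
  fixes J :: "nat \<Rightarrow> 'a::ab_group_add"
  shows "(\<Sum>i=1..n. J i - J (i - 1)) = J n - J 0"
  \<comment> \<open>The sum starts at 1, so truncated subtraction never acts on 0; the induction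
    step adds \<open>J (Suc n) - J n\<close>.\<close>
  by (induction n) auto

lemma upwind_sav_step_mass:
  assumes "upwind_sav_step Nx dx dt \<epsilon> k I F F' \<phi> \<psi> \<xi>"
  shows "(\<Sum>i=1..Nx. \<psi> i) = (\<Sum>i=1..Nx. \<phi> i)"
proof -
  obtain J :: "nat \<Rightarrow> real"
    where J: "\<forall>i\<in>{1..Nx}. \<psi> i - \<phi> i = - (dt / dx) * (J i - J (i - 1))"
      and bdry: "J 0 = 0" "J Nx = 0"
    using assms unfolding upwind_sav_step_def by blast
  have "(\<Sum>i=1..Nx. \<psi> i) - (\<Sum>i=1..Nx. \<phi> i) = (\<Sum>i=1..Nx. \<psi> i - \<phi> i)"
    by (rule sum_subtractf [symmetric])
  also have "\<dots> = (\<Sum>i=1..Nx. - (dt / dx) * (J i - J (i - 1)))"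
    using J by (intro sum.cong) auto
  also have "\<dots> = - (dt / dx) * (J Nx - J 0)"
    by (simp only: sum_distrib_left [symmetric] sum_diff_pred_telescope)
  also have "\<dots> = 0"
    using bdry by simp
  finally show ?thesis
    by simp
qed

theorem theorem2:
  fixes Nx N k :: nat and dx dt \<epsilon> :: real
    and I :: "real set" and F F' :: "real \<Rightarrow> real"
    and \<phi> :: "nat \<Rightarrow> nat \<Rightarrow> real" and \<xi> :: "nat \<Rightarrow> real"
  assumes "Nx \<ge> 2" and "dx > 0" and "dt > 0" and "\<epsilon> > 0" and "k > 0"
    and "is_interval I"
    and "\<And>x. x \<in> I \<Longrightarrow> (F has_real_derivative F' x) (at x within I)"
    and "\<And>n. n < N \<Longrightarrow> upwind_sav_step Nx dx dt \<epsilon> k I F F' (\<phi> n) (\<phi> (Suc n)) (\<xi> (Suc n))"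
  shows "\<forall>n<N. \<forall>m\<le>n. (\<Sum>i=1..Nx. \<phi> (Suc n) i) = (\<Sum>i=1..Nx. \<phi> m i)"
proof (intro allI impI)
  \<comment> \<open>Comparing each time level with level 0 lets a single induction serve both
    \<open>Suc n\<close> and \<open>m\<close>. The bound includes \<open>N\<close>, since
    \<open>n < N\<close> allows \<open>Suc n = N\<close>.\<close>
  have mass: "(\<Sum>i=1..Nx. \<phi> j i) = (\<Sum>i=1..Nx. \<phi> 0 i)" if "j \<le> N" for j
    using that
  proof (induction j)
    case (Suc j)
    then show ?case
      using upwind_sav_step_mass [OF assms(8) [of j]] by simp
  qed simp
  fix n m
  assume "n < N" and "m \<le> n"
  then show "(\<Sum>i=1..Nx. \<phi> (Suc n) i) = (\<Sum>i=1..Nx. \<phi> m i)"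
    using mass [of "Suc n"] mass [of m] by simp
qed

end
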